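(* Let $\mu$ be a probability measure on $\mathcal U\times\mathcal V$ with marginals $\mu_u,\mu_v$ and conditionals $\mu_{u|v}(\cdot|v)$, $\mu_{v|u}(\cdot|u)$, and assume $$\mathbb E_{v\sim\mu_v}\mathsf D_{\mathsf{kl}}(\mu_{u|v}(\cdot|v)\,\|\,\mu_u)<\infty,\qquad \mathbb E_{u\sim\mu_u}\mathsf D_{\mathsf{kl}}(\mu_{v|u}(\cdot|u)\,\|\,\mu_v)<\infty .$$ Let $\mathsf J_{\mathsf{cond}}$ and $\mathsf L_{\mathsf{cond}}$ be the functions of $\theta\in\mathbb R^p$ defined in the context. Then there is a constant $C$, depending only on the expected relative entropies $\mathbb E_{v\sim\mu_v}\mathsf D_{\mathsf{kl}}(\mu_{u|v}(\cdot|v)\,\|\,\mu_u)$ and $\mathbb E_{u\sim\mu_u}\mathsf D_{\mathsf{kl}}(\mu_{v|u}(\cdot|u)\,\|\,\mu_v)$ of the conditionals of $\mu$ and not on $\theta$, such that $$\mathsf J_{\mathsf{cond}}(\theta)=\mathsf L_{\mathsf{cond}}(\theta)+C\qquad\text{for all }\theta\in\mathbb R^p.$$ Consequently $\mathsf J_{\mathsf{cond}}$ and $\mathsf L_{\mathsf{cond}}$ have the same minimizers over $\mathbb R^p$.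
   Context: $\mathcal U,\mathcal V$ are measurable spaces on which regular conditional distributions of $\mu$ exist. For $\theta=(\theta_u,\theta_v)\in\mathbb R^p$, $\bar g_u(\cdot;\theta_u):\mathcal U\to\mathbb S^{n_e-1}$ and $\bar g_v(\cdot;\theta_v):\mathcal V\to\mathbb S^{n_e-1}$ are measurable maps into the Euclidean unit sphere of $\mathbb R^{n_e}$, $\tau>0$ is fixed, and $s_\theta(u,v)=\langle\bar g_u(u;\theta_u),\bar g_v(v;\theta_v)\rangle/\tau$. Define the densities $$\rho(u|v;\theta)=\frac{e^{s_\theta(u,v)}}{\mathbb E_{u'\sim\mu_u}e^{s_\theta(u',v)}},\qquad \rho(v|u;\theta)=\frac{e^{s_\theta(u,v)}}{\mathbb E_{v'\sim\mu_v}e^{s_\theta(u,v')}},$$ and the model conditionals $\nu_{u|v}(du|v;\theta)=\rho(u|v;\theta)\mu_u(du)$ and $\nu_{v|u}(dv|u;\theta)=\rho(v|u;\theta)\mu_v(dv)$. (These are the conditionals of the probability measure $\nu(du,dv;\theta)\propto e^{s_\theta(u,v)}\mu_u(du)\mu_v(dv)$.) Define $$\mathsf L_{\mathsf{cond}}(\theta)=-\tfrac12\mathbb E_{(u,v)\sim\mu}\bigl[\log\rho(u|v;\theta)+\log\rho(v|u;\theta)\bigr],$$ $$\mathsf J_{\mathsf{cond}}(\theta)=\tfrac12\mathbb E_{v\sim\mu_v}\bigl[\mathsf D_{\mathsf{kl}}(\mu_{u|v}(\cdot|v)\|\nu_{u|v}(\cdot|v;\theta))\bigr]+\tfrac12\mathbb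 E_{u\sim\mu_u}\bigl[\mathsf D_{\mathsf{kl}}(\mu_{v|u}(\cdot|u)\|\nu_{v|u}(\cdot|u;\theta))\bigr].$$ $\mathsf D_{\mathsf{kl}}(\pi\|\pi')=\mathbb E_\pi[\log(d\pi/d\pi')]$ is the Kullback–Leibler divergence ($+\infty$ if $\pi\not\ll\pi'$). *)

theory Defs
  imports "HOL-Probability.Probability"
begin

text \<open>
  The expectation of an extended-real function, as positive part minus negative part. It is
  meaningful whenever one of the two parts is finite, which is the case for all uses below.
  For a non-measurable integrand each part is a lower integral.
\<close>

definition ext_expectation :: "'a measure \<Rightarrow> ('a \<Rightarrow> ereal) \<Rightarrow> ereal" where
  "ext_expectation M f =
     enn2ereal (\<integral>\<^sup>+x. e2ennreal (f x) \<partial>M) - enn2ereal (\<integral>\<^sup>+x. e2ennreal (- f x) \<partial>M)"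

text \<open>
  The library's \<^const>\<open>KL_divergence\<close> is real-valued and hence a junk value when the divergence is
  infinite, so the divergence with values in the extended reals is introduced here. Note the order
  of the arguments: \<open>entropy_density b N M\<close> is the logarithm of the density of \<open>M\<close> with respect
  to \<open>N\<close>, and \<open>absolutely_continuous N M\<close> says \<open>M \<lless> N\<close>. The base \<open>exp 1\<close> gives the natural logarithm.
\<close>

definition KL :: "'a measure \<Rightarrow> 'a measure \<Rightarrow> ereal" where
  "KL M N =
     (if absolutely_continuous N M
      then ext_expectation M (\<lambda>x. ereal (entropy_density (exp 1) N M x))
      else \<infinity>)"

lemma ext_expectation_integrable:
  fixes f :: "'a \<Rightarrow> real"
  assumes "integrable M f"
  shows "ext_expectation M (\<lambda>x. ereal (f x)) = ereal (integral\<^sup>L M f)"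
proof -
  have pos: "(\<integral>\<^sup>+x. ennreal (f x) \<partial>M) < \<infinity>" and neg: "(\<integral>\<^sup>+x. ennreal (- f x) \<partial>M) < \<infinity>"
    using assms by (auto simp: real_integrable_def top.not_eq_extremum)
  show ?thesis
    using pos neg
    by (cases "\<integral>\<^sup>+x. ennreal (f x) \<partial>M"; cases "\<integral>\<^sup>+x. ennreal (- f x) \<partial>M")
       (auto simp: ext_expectation_def real_lebesgue_integral_def[OF assms]
                   e2ennreal_ereal enn2ereal_ennreal)
qed

lemma KL_eq_KL_divergence:
  assumes "absolutely_continuous N M" and "integrable M (entropy_density (exp 1) N M)"
  shows "KL M N = ereal (KL_divergence (exp 1) N M)"
  using assms by (simp add: KL_def KL_divergence_def ext_expectation_integrable)

text \<open>
  \<open>\<kappa>\<close> is a regular conditional distribution of \<open>X\<close> given \<open>Y\<close> under \<open>M\<close>, for random variables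
  \<open>X\<close> and \<open>Y\<close> with values in the measurable spaces \<open>S\<close> and \<open>T\<close>.
\<close>

definition regular_cond_distr ::
  "'a measure \<Rightarrow> 'b measure \<Rightarrow> ('a \<Rightarrow> 'b) \<Rightarrow> 'c measure \<Rightarrow> ('a \<Rightarrow> 'c) \<Rightarrow> ('c \<Rightarrow> 'b measure) \<Rightarrow> bool"
where
  "regular_cond_distr M S X T Y \<kappa> \<longleftrightarrow>
     \<kappa> \<in> T \<rightarrow>\<^sub>M prob_algebra S \<and>
     (\<forall>A\<in>sets S. \<forall>B\<in>sets T.
        emeasure M {\<omega>\<in>space M. X \<omega> \<in> A \<and> Y \<omega> \<in> B} =
        (\<integral>\<^sup>+y\<in>B. emeasure (\<kappa> y) A \<partial>distr M T Y))"

definition expected_KL ::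
  "'b measure \<Rightarrow> ('b \<Rightarrow> 'a measure) \<Rightarrow> ('b \<Rightarrow> 'a measure) \<Rightarrow> ereal" where
  "expected_KL M \<kappa> \<kappa>' = ext_expectation M (\<lambda>y. KL (\<kappa> y) (\<kappa>' y))"

text \<open>
  In what follows \<open>gu\<close> and \<open>gv\<close> are the normalized encoders, taking the parameter first, and
  \<open>\<theta> = (\<theta>\<^sub>u, \<theta>\<^sub>v)\<close>. The measures \<open>U\<close> and \<open>V\<close> only serve as measurable spaces.
\<close>

definition score ::
  "('a \<Rightarrow> 'u \<Rightarrow> 'e::real_inner) \<Rightarrow> ('b \<Rightarrow> 'v \<Rightarrow> 'e) \<Rightarrow> real \<Rightarrow> 'a \<times> 'b \<Rightarrow> 'u \<Rightarrow> 'v \<Rightarrow> real" where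
  "score gu gv \<tau> \<theta> u v = inner (gu (fst \<theta>) u) (gv (snd \<theta>) v) / \<tau>"

definition marg_u :: "'u measure \<Rightarrow> ('u \<times> 'v) measure \<Rightarrow> 'u measure" where
  "marg_u U \<mu> = distr \<mu> U fst"

definition marg_v :: "'v measure \<Rightarrow> ('u \<times> 'v) measure \<Rightarrow> 'v measure" where
  "marg_v V \<mu> = distr \<mu> V snd"

definition rho_u_given_v :: "'u measure \<Rightarrow> ('u \<Rightarrow> 'v \<Rightarrow> real) \<Rightarrow> 'v \<Rightarrow> 'u \<Rightarrow> real" where
  "rho_u_given_v \<mu>u s v u = exp (s u v) / (\<integral>u'. exp (s u' v) \<partial>\<mu>u)"

definition rho_v_given_u :: "'v measure \<Rightarrow> ('u \<Rightarrow> 'v \<Rightarrow> real) \<Rightarrow> 'u \<Rightarrow> 'v \<Rightarrow> real" where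
  "rho_v_given_u \<mu>v s u v = exp (s u v) / (\<integral>v'. exp (s u v') \<partial>\<mu>v)"

definition nu_u_given_v :: "'u measure \<Rightarrow> ('u \<Rightarrow> 'v \<Rightarrow> real) \<Rightarrow> 'v \<Rightarrow> 'u measure" where
  "nu_u_given_v \<mu>u s v = density \<mu>u (\<lambda>u. ennreal (rho_u_given_v \<mu>u s v u))"

definition nu_v_given_u :: "'v measure \<Rightarrow> ('u \<Rightarrow> 'v \<Rightarrow> real) \<Rightarrow> 'u \<Rightarrow> 'v measure" where
  "nu_v_given_u \<mu>v s u = density \<mu>v (\<lambda>v. ennreal (rho_v_given_u \<mu>v s u v))"

definition L_cond ::
  "'u measure \<Rightarrow> 'v measure \<Rightarrow> ('u \<times> 'v) measure \<Rightarrow>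
   ('a \<Rightarrow> 'u \<Rightarrow> 'e::real_inner) \<Rightarrow> ('b \<Rightarrow> 'v \<Rightarrow> 'e) \<Rightarrow> real \<Rightarrow> 'a \<times> 'b \<Rightarrow> real" where
  "L_cond U V \<mu> gu gv \<tau> \<theta> =
     - (1/2) * (\<integral>(u, v). ln (rho_u_given_v (marg_u U \<mu>) (score gu gv \<tau> \<theta>) v u)
                         + ln (rho_v_given_u (marg_v V \<mu>) (score gu gv \<tau> \<theta>) u v) \<partial>\<mu>)"

definition J_cond ::
  "'u measure \<Rightarrow> 'v measure \<Rightarrow> ('u \<times> 'v) measure \<Rightarrow> ('v \<Rightarrow> 'u measure) \<Rightarrow> ('u \<Rightarrow> 'v measure) \<Rightarrow>
   ('a \<Rightarrow> 'u \<Rightarrow> 'e::real_inner) \<Rightarrow> ('b \<Rightarrow> 'v \<Rightarrow> 'e) \<Rightarrow> real \<Rightarrow> 'a \<times> 'b \<Rightarrow> ereal" where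
  "J_cond U V \<mu> \<mu>uv \<mu>vu gu gv \<tau> \<theta> =
     ereal (1/2) * expected_KL (marg_v V \<mu>) \<mu>uv (nu_u_given_v (marg_u U \<mu>) (score gu gv \<tau> \<theta>))
   + ereal (1/2) * expected_KL (marg_u U \<mu>) \<mu>vu (nu_v_given_u (marg_v V \<mu>) (score gu gv \<tau> \<theta>))"

end

theory Submission
  imports Defs
begin

text \<open>
  For fixed \<open>v\<close> the model density \<open>\<rho>(\<cdot>|v)\<close> is bounded away from \<open>0\<close> and \<open>\<infinity>\<close>, because the score of unit
  vectors is bounded by \<open>1/\<tau>\<close>. Hence \<open>KL(\<mu>\<^sub>u\<^sub>|\<^sub>v, \<nu>\<^sub>u\<^sub>|\<^sub>v)\<close> is \<open>KL(\<mu>\<^sub>u\<^sub>|\<^sub>v, \<mu>\<^sub>u) - \<integral> ln \<rho>(u|v) \<mu>\<^sub>u\<^sub>|\<^sub>v(du)\<close>,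
  also when the divergences are infinite. Averaging over \<open>v\<close> and disintegrating \<open>\<mu>\<close> turns the last
  term into \<open>\<integral> ln \<rho> d\<mu>\<close>; with the symmetric computation for \<open>v\<close> given \<open>u\<close>, the constant is half
  the sum of the two expected relative entropies.
\<close>

section \<open>Lower integrals and extended-real expectations of differences\<close>

text \<open>
  The function \<open>f\<close> need not be measurable (its integral is then a lower integral). This matters
  since \<open>v \<mapsto> KL(\<mu>\<^sub>u\<^sub>|\<^sub>v, \<mu>\<^sub>u)\<close> may fail to be measurable on a \<open>\<sigma>\<close>-algebra that is not countably generated.
\<close>

lemma nn_integral_add_measurable:
  fixes f h :: "'a \<Rightarrow> ennreal"
  assumes [measurable]: "h \<in> borel_measurable M" and fin: "\<And>x. x \<in> space M \<Longrightarrow> h x < \<infinity>"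
  shows "(\<integral>\<^sup>+x. f x + h x \<partial>M) = (\<integral>\<^sup>+x. f x \<partial>M) + (\<integral>\<^sup>+x. h x \<partial>M)"
proof (rule antisym)
  show "(\<integral>\<^sup>+x. f x + h x \<partial>M) \<le> (\<integral>\<^sup>+x. f x \<partial>M) + (\<integral>\<^sup>+x. h x \<partial>M)"
    unfolding nn_integral_def[of M "\<lambda>x. f x + h x"]
  proof (intro SUP_least, safe)
    fix g assume g: "simple_function M g" "g \<le> (\<lambda>x. f x + h x)"
    have [measurable]: "g \<in> borel_measurable M"
      by (rule borel_measurable_simple_function) fact
    have "integral\<^sup>S M g = (\<integral>\<^sup>+x. g x \<partial>M)"
      by (simp add: nn_integral_eq_simple_integral g)
    also have "\<dots> \<le> (\<integral>\<^sup>+x. (g x - h x) + h x \<partial>M)"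
      by (intro nn_integral_mono) (auto simp: diff_add_self_ennreal not_le intro: less_imp_le)
    also have "\<dots> = (\<integral>\<^sup>+x. g x - h x \<partial>M) + (\<integral>\<^sup>+x. h x \<partial>M)"
      by (simp add: nn_integral_add)
    \<comment> \<open>Finiteness of \<open>h\<close> enters here: in \<open>ennreal\<close> one has
      \<open>top - top = top\<close>, so \<open>g x - h x \<le> f x\<close> could fail where
      \<open>h x = top\<close>.\<close>
    also have "(\<integral>\<^sup>+x. g x - h x \<partial>M) \<le> (\<integral>\<^sup>+x. f x \<partial>M)"
    proof (rule nn_integral_mono)
      show "g x - h x \<le> f x" if "x \<in> space M" for x
        using le_funD[OF g(2), of x] fin[OF that]
        by (auto simp: ennreal_minus_le_iff add.commute)
    qed
    finally show "integral\<^sup>S M g \<le> (\<integral>\<^sup>+x. f x \<partial>M) + (\<integral>\<^sup>+x. h x \<partial>M)"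
      by (simp add: add_right_mono)
  qed
  show "(\<integral>\<^sup>+x. f x \<partial>M) + (\<integral>\<^sup>+x. h x \<partial>M) \<le> (\<integral>\<^sup>+x. f x + h x \<partial>M)"
  proof -
    \<comment> \<open>Adding a constant commutes with a supremum over a nonempty set, so the sum is
      approximated by simple functions below \<open>f\<close> alone.\<close>
    have "{g. simple_function M g \<and> g \<le> f} \<noteq> {}"
      by (auto intro!: exI[of _ "\<lambda>_. 0"] simp: le_fun_def)
    then have "(\<integral>\<^sup>+x. f x \<partial>M) + (\<integral>\<^sup>+x. h x \<partial>M) =
        (SUP g\<in>{g. simple_function M g \<and> g \<le> f}. integral\<^sup>S M g + (\<integral>\<^sup>+x. h x \<partial>M))"
      unfolding nn_integral_def[of M f] by (simp add: ennreal_SUP_add_left)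
    also have "\<dots> \<le> (\<integral>\<^sup>+x. f x + h x \<partial>M)"
    proof (intro SUP_least, safe)
      fix g assume g: "simple_function M g" "g \<le> f"
      have [measurable]: "g \<in> borel_measurable M"
        by (rule borel_measurable_simple_function) fact
      have "integral\<^sup>S M g + (\<integral>\<^sup>+x. h x \<partial>M) = (\<integral>\<^sup>+x. g x + h x \<partial>M)"
        by (simp add: nn_integral_eq_simple_integral[OF g(1), symmetric] nn_integral_add)
      also have "\<dots> \<le> (\<integral>\<^sup>+x. f x + h x \<partial>M)"
        using g(2) by (intro nn_integral_mono add_right_mono) (auto simp: le_fun_def)
      finally show "integral\<^sup>S M g + (\<integral>\<^sup>+x. h x \<partial>M) \<le> (\<integral>\<^sup>+x. f x + h x \<partial>M)" .
    qed
    finally show ?thesis .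
  qed
qed

lemma integrable_pos_neg_parts:
  fixes h :: "'a \<Rightarrow> real"
  assumes "integrable M h"
  obtains p q where "0 \<le> p" "0 \<le> q" "(\<integral>\<^sup>+x. ennreal (h x) \<partial>M) = ennreal p"
    "(\<integral>\<^sup>+x. ennreal (- h x) \<partial>M) = ennreal q" "integral\<^sup>L M h = p - q"
proof -
  have "(\<integral>\<^sup>+x. ennreal (h x) \<partial>M) < \<infinity>" "(\<integral>\<^sup>+x. ennreal (- h x) \<partial>M) < \<infinity>"
    using assms by (auto simp: real_integrable_def top.not_eq_extremum)
  with real_lebesgue_integral_def[OF assms] that show thesis
    by (cases "\<integral>\<^sup>+x. ennreal (h x) \<partial>M"; cases "\<integral>\<^sup>+x. ennreal (- h x) \<partial>M") auto
qed

lemma ext_expectation_cong_AE: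
  assumes "AE x in M. f x = g x"
  shows "ext_expectation M f = ext_expectation M g"
proof -
  have "(\<integral>\<^sup>+x. e2ennreal (f x) \<partial>M) = (\<integral>\<^sup>+x. e2ennreal (g x) \<partial>M)"
    "(\<integral>\<^sup>+x. e2ennreal (- f x) \<partial>M) = (\<integral>\<^sup>+x. e2ennreal (- g x) \<partial>M)"
    using assms by (auto intro!: nn_integral_cong_AE)
  then show ?thesis by (simp add: ext_expectation_def)
qed

lemma ext_expectation_nonneg:
  assumes "\<And>x. x \<in> space M \<Longrightarrow> 0 \<le> f x"
  shows "ext_expectation M f = enn2ereal (\<integral>\<^sup>+x. e2ennreal (f x) \<partial>M)"
proof -
  have "(\<integral>\<^sup>+x. e2ennreal (- f x) \<partial>M) = (\<integral>\<^sup>+x. 0 \<partial>M)"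
    using assms by (intro nn_integral_cong e2ennreal_neg) auto
  then show ?thesis by (simp add: ext_expectation_def zero_ennreal.rep_eq)
qed

text \<open>Both integrands are nonnegative, so their negative parts vanish and no difference of
  infinities arises, even where \<open>f\<close> is infinite. Measurability is available for
  \<open>h\<close> only, so additivity comes from \<open>nn_integral_add_measurable\<close>.\<close>

lemma ext_expectation_diff_nonneg:
  fixes f :: "'a \<Rightarrow> ereal" and h :: "'a \<Rightarrow> real"
  assumes f: "\<And>x. x \<in> space M \<Longrightarrow> 0 \<le> f x"
    and fh: "\<And>x. x \<in> space M \<Longrightarrow> 0 \<le> f x - ereal (h x)"
    and h: "integrable M h"
  shows "ext_expectation M (\<lambda>x. f x - ereal (h x)) = ext_expectation M f - ereal (integral\<^sup>L M h)"
proof -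
  have [measurable]: "h \<in> borel_measurable M" using h by auto
  \<comment> \<open>With h^+ and h^- for the parts of \<open>h\<close>, this is (f - h) + h^+ = f +
    h^-, which stays valid when \<open>f x\<close> is infinite.\<close>
  have pointwise: "e2ennreal (f x - ereal (h x)) + ennreal (h x) = e2ennreal (f x) + ennreal (- h x)"
    if "x \<in> space M" for x
    using f[OF that] fh[OF that]
    by (cases "f x"; cases "0 \<le> h x") (auto simp: ennreal_neg ennreal_plus[symmetric] simp del: ennreal_plus)
  have eq: "(\<integral>\<^sup>+x. e2ennreal (f x - ereal (h x)) \<partial>M) + (\<integral>\<^sup>+x. ennreal (h x) \<partial>M) =
      (\<integral>\<^sup>+x. e2ennreal (f x) \<partial>M) + (\<integral>\<^sup>+x. ennreal (- h x) \<partial>M)"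
    by (simp add: nn_integral_add_measurable[symmetric] pointwise cong: nn_integral_cong)
  obtain p q where "0 \<le> p" "0 \<le> q" "(\<integral>\<^sup>+x. ennreal (h x) \<partial>M) = ennreal p"
    "(\<integral>\<^sup>+x. ennreal (- h x) \<partial>M) = ennreal q" "integral\<^sup>L M h = p - q"
    by (rule integrable_pos_neg_parts[OF h])
  moreover have "ext_expectation M f = enn2ereal (\<integral>\<^sup>+x. e2ennreal (f x) \<partial>M)"
    by (rule ext_expectation_nonneg) (rule f)
  moreover have "ext_expectation M (\<lambda>x. f x - ereal (h x)) =
      enn2ereal (\<integral>\<^sup>+x. e2ennreal (f x - ereal (h x)) \<partial>M)"
    by (rule ext_expectation_nonneg) (rule fh)
  ultimately show ?thesis
    using eq
    by (cases "\<integral>\<^sup>+x. e2ennreal (f x - ereal (h x)) \<partial>M"; cases "\<integral>\<^sup>+x. e2ennreal (f x) \<partial>M")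
       (auto simp: ennreal_plus[symmetric] simp del: ennreal_plus)
qed

text \<open>The variant for integrands of changing sign, such as log densities. The positive part of
  \<open>f\<close> may have infinite integral, but the finite negative part keeps both expectations
  away from \<infinity> - \<infinity>.\<close>

lemma ext_expectation_diff_real:
  fixes f h :: "'a \<Rightarrow> real"
  assumes [measurable]: "f \<in> borel_measurable M"
    and neg: "(\<integral>\<^sup>+x. ennreal (- f x) \<partial>M) < \<infinity>" and h: "integrable M h"
  shows "ext_expectation M (\<lambda>x. ereal (f x - h x)) =
    ext_expectation M (\<lambda>x. ereal (f x)) - ereal (integral\<^sup>L M h)"
proof -
  have [measurable]: "h \<in> borel_measurable M" using h by auto
  obtain p q where pq: "0 \<le> p" "0 \<le> q" "(\<integral>\<^sup>+x. ennreal (h x) \<partial>M) = ennreal p"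
    "(\<integral>\<^sup>+x. ennreal (- h x) \<partial>M) = ennreal q" "integral\<^sup>L M h = p - q"
    by (rule integrable_pos_neg_parts[OF h])
  \<comment> \<open>The bound (f - h)^- \<le> f^- + h^+ makes the negative part of the difference
    finite as well.\<close>
  have "(\<integral>\<^sup>+x. ennreal (- (f x - h x)) \<partial>M) \<le> (\<integral>\<^sup>+x. ennreal (- f x) + ennreal (h x) \<partial>M)"
    by (intro nn_integral_mono) (auto simp: ennreal_plus_if ennreal_neg intro!: ennreal_leI)
  also have "\<dots> < \<infinity>"
    using neg pq by (simp add: nn_integral_add ennreal_add_eq_top less_top)
  finally have neg': "(\<integral>\<^sup>+x. ennreal (- (f x - h x)) \<partial>M) < \<infinity>" .
  \<comment> \<open>The identity (f - h)^+ + f^- + h^+ = (f - h)^- + f^+ + h^- is free of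
    subtraction; after integration the finite terms can be cancelled.\<close>
  have "ennreal (f x - h x) + (ennreal (- f x) + ennreal (h x)) =
      ennreal (- (f x - h x)) + (ennreal (f x) + ennreal (- h x))" for x
    by (auto simp: ennreal_plus_if ennreal_neg)
  then have "(\<integral>\<^sup>+x. ennreal (f x - h x) + (ennreal (- f x) + ennreal (h x)) \<partial>M) =
      (\<integral>\<^sup>+x. ennreal (- (f x - h x)) + (ennreal (f x) + ennreal (- h x)) \<partial>M)"
    by simp
  then have eq: "(\<integral>\<^sup>+x. ennreal (f x - h x) \<partial>M) + ((\<integral>\<^sup>+x. ennreal (- f x) \<partial>M) + ennreal p) =
      (\<integral>\<^sup>+x. ennreal (- (f x - h x)) \<partial>M) + ((\<integral>\<^sup>+x. ennreal (f x) \<partial>M) + ennreal q)"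
    using pq by (simp add: nn_integral_add del: minus_diff_eq)
  then show ?thesis
    using neg neg' pq
    unfolding ext_expectation_def e2ennreal_ereal uminus_ereal.simps
    by (cases "\<integral>\<^sup>+x. ennreal (f x - h x) \<partial>M"; cases "\<integral>\<^sup>+x. ennreal (- (f x - h x)) \<partial>M";
        cases "\<integral>\<^sup>+x. ennreal (f x) \<partial>M"; cases "\<integral>\<^sup>+x. ennreal (- f x) \<partial>M")
       (auto simp: ennreal_plus[symmetric] simp del: ennreal_plus minus_diff_eq)
qed

section \<open>Kullback-Leibler divergence: Gibbs' inequality and change of the reference
  measure\<close>

text \<open>
  Gibbs' inequality from \<open>1 - ln z \<le> 1/z\<close>, in terms of positive and negative parts so that
  it also covers infinite divergence.
\<close>

lemma (in prob_space) log_likelihood_parts: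
  assumes P: "prob_space P" "absolutely_continuous M P" "sets P = sets M"
  shows "(\<integral>\<^sup>+x. ennreal (- entropy_density (exp 1) M P x) \<partial>P) \<le> 1"
    and "(\<integral>\<^sup>+x. ennreal (- entropy_density (exp 1) M P x) \<partial>P)
       \<le> (\<integral>\<^sup>+x. ennreal (entropy_density (exp 1) M P x) \<partial>P)"
proof -
  let ?D = "RN_deriv M P" and ?f = "entropy_density (exp 1) M P"
  note [measurable_cong] = P(3)
  interpret P: prob_space P by fact
  have [measurable]: "?f \<in> borel_measurable P" by measurable
  \<comment> \<open>The expectation of 1/z under \<open>P\<close>, for z = dP/dM, is at most 1.
    Equality may fail, since \<open>?D x * inverse (?D x)\<close> is 0 where \<open>?D x\<close> is
    0 or \<open>top\<close>.\<close>
  have "(\<integral>\<^sup>+x. inverse (?D x) \<partial>P) = (\<integral>\<^sup>+x. ?D x * inverse (?D x) \<partial>M)"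
    using P by (subst RN_deriv_nn_integral[of P]) auto
  also have "\<dots> \<le> (\<integral>\<^sup>+x. 1 \<partial>M)"
  proof (intro nn_integral_mono)
    show "?D x * inverse (?D x) \<le> 1" for x
      by (cases "?D x = 0 \<or> ?D x = top")
         (auto simp: ennreal_mult_divide_eq[symmetric] divide_ennreal_def[symmetric] ennreal_divide_self less_top)
  qed
  finally have inv: "(\<integral>\<^sup>+x. inverse (?D x) \<partial>P) \<le> 1"
    by (simp add: emeasure_space_1)
  have "AE x in M. ?D x \<noteq> \<infinity>"
    using P by (intro RN_deriv_finite) (auto intro: P.sigma_finite_measure_axioms)
  then have fin: "AE x in P. ?D x \<noteq> \<infinity>"
    using P absolutely_continuous_AE by blast
  have f: "?f x = ln (enn2real (?D x))" for x
    by (simp add: entropy_density_def log_def)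
  \<comment> \<open>This is 1 - ln z \<le> 1/z with the positive part of ln z moved to the right. At
    z = 0 the right side is \<open>top\<close>.\<close>
  have pointwise: "AE x in P. 1 + ennreal (- ?f x) \<le> inverse (?D x) + ennreal (?f x)"
    using fin
  proof eventually_elim
    fix x assume "?D x \<noteq> \<infinity>"
    then obtain r where r: "0 \<le> r" "?D x = ennreal r" by (cases "?D x") auto
    show "1 + ennreal (- ?f x) \<le> inverse (?D x) + ennreal (?f x)"
    proof (cases "r = 0")
      case False
      with r have "0 < r" by simp
      then have "1 - ln r \<le> inverse r"
        using ln_le_minus_one[of "inverse r"] by (simp add: ln_inverse)
      then show ?thesis
        using \<open>0 < r\<close> r(2) unfolding f
        by (cases "0 \<le> ln r")
           (auto simp: inverse_ennreal ennreal_neg ennreal_plus[symmetric] ennreal_1[symmetric]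
             simp del: ennreal_plus ennreal_1 intro!: ennreal_leI)
    qed (use r in simp)
  qed
  have "1 + (\<integral>\<^sup>+x. ennreal (- ?f x) \<partial>P) = (\<integral>\<^sup>+x. 1 + ennreal (- ?f x) \<partial>P)"
    by (simp add: nn_integral_add P.emeasure_space_1)
  also have "\<dots> \<le> (\<integral>\<^sup>+x. inverse (?D x) + ennreal (?f x) \<partial>P)"
    by (rule nn_integral_mono_AE) fact
  also have "\<dots> = (\<integral>\<^sup>+x. inverse (?D x) \<partial>P) + (\<integral>\<^sup>+x. ennreal (?f x) \<partial>P)"
    by (simp add: nn_integral_add)
  also have "\<dots> \<le> 1 + (\<integral>\<^sup>+x. ennreal (?f x) \<partial>P)"
    using inv by (intro add_right_mono)
  finally show "(\<integral>\<^sup>+x. ennreal (- ?f x) \<partial>P) \<le> (\<integral>\<^sup>+x. ennreal (?f x) \<partial>P)"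
    by (simp add: ennreal_add_left_cancel_le)
  \<comment> \<open>Where the log density is negative its positive part is 0, and the pointwise
    inequality bounds the negative part by 1/z; elsewhere the negative part is 0.\<close>
  have "AE x in P. ennreal (- ?f x) \<le> inverse (?D x)"
    using pointwise
  proof eventually_elim
    fix x assume x: "1 + ennreal (- ?f x) \<le> inverse (?D x) + ennreal (?f x)"
    show "ennreal (- ?f x) \<le> inverse (?D x)"
    proof (cases "0 \<le> ?f x")
      case False
      have "ennreal (- ?f x) \<le> 1 + ennreal (- ?f x)" by simp
      also have "\<dots> \<le> inverse (?D x)" using x False by (simp add: ennreal_neg)
      finally show ?thesis .
    qed (simp add: ennreal_neg)
  qed
  then have "(\<integral>\<^sup>+x. ennreal (- ?f x) \<partial>P) \<le> (\<integral>\<^sup>+x. inverse (?D x) \<partial>P)"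
    by (rule nn_integral_mono_AE)
  with inv show "(\<integral>\<^sup>+x. ennreal (- ?f x) \<partial>P) \<le> 1" by simp
qed

lemma KL_nonneg_ereal:
  assumes "prob_space N" "prob_space P" "sets P = sets N"
  shows "0 \<le> KL P N"
  using prob_space.log_likelihood_parts[OF assms(1,2) _ assms(3)]
  by (auto simp: KL_def ext_expectation_def ereal_diff_positive less_eq_ennreal.rep_eq)

text \<open>By the chain rule dP/d(rN) = (dP/dN)/r, so the log densities differ by ln r. The
  negative part of the log density integrates to at most 1 and ln r is integrable, so the difference
  can be taken outside the expectation even if the divergence is infinite.\<close>

lemma KL_density_right:
  fixes r :: "'a \<Rightarrow> real"
  assumes N: "prob_space N" and P: "prob_space P" and sets: "sets P = sets N"
    and r[measurable]: "r \<in> borel_measurable N" and r_pos: "\<And>x. x \<in> space N \<Longrightarrow> 0 < r x"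
    and rN: "prob_space (density N r)"
    and int: "integrable P (\<lambda>x. ln (r x))"
  shows "KL P (density N r) = KL P N - ereal (\<integral>x. ln (r x) \<partial>P)"
proof -
  interpret N: prob_space N by fact
  interpret P: prob_space P by fact
  let ?Q = "density N r"
  interpret Q: prob_space ?Q by fact
  note [measurable_cong] = sets
  \<comment> \<open>A positive density leaves the null sets unchanged, so \<open>P\<close> is
    absolutely continuous with respect to both measures or to neither; in the latter case both sides
    are \<infinity>.\<close>
  have AE_Q: "(AE x in ?Q. R x) \<longleftrightarrow> (AE x in N. R x)" for R
    by (subst AE_density) (auto intro!: AE_cong simp: r_pos)
  have null: "null_sets ?Q = null_sets N"
    by (intro set_eqI) (metis AE_Q AE_iff_null_sets null_setsD2 sets_density)
  have ac: "absolutely_continuous ?Q P \<longleftrightarrow> absolutely_continuous N P"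
    by (simp add: absolutely_continuous_def null)
  show ?thesis
  proof (cases "absolutely_continuous N P")
    case True
    let ?D = "RN_deriv N P" and ?E = "RN_deriv ?Q P"
    \<comment> \<open>Both \<open>?D\<close> and \<open>r * ?E\<close> are densities of
      \<open>P\<close> with respect to \<open>N\<close>, so uniqueness of the Radon-Nikodym
      derivative identifies them.\<close>
    have "density N ?D = P"
      using True sets by (rule N.density_RN_deriv)
    moreover have "density N (\<lambda>x. ennreal (r x) * ?E x) = P"
      using Q.density_RN_deriv[of P] ac True sets by (simp add: density_density_eq)
    ultimately have "AE x in N. ennreal (r x) * ?E x = ?D x"
      by (intro N.RN_deriv_unique) auto
    then have "AE x in P. ennreal (r x) * ?E x = ?D x"
      using absolutely_continuous_AE[OF _ True] sets by auto
    \<comment> \<open>Positivity and finiteness of \<open>?D\<close> pass to \<open>?E\<close>, so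
      neither \<open>ln\<close> at 0 nor \<open>enn2real\<close> at \<open>top\<close> yields a
      default value in the product rule for \<open>ln\<close>.\<close>
    moreover have "AE x in P. 0 < ?D x"
    proof -
      have "AE x in density N ?D. 0 < ?D x"
        by (subst AE_density) auto
      then show ?thesis by (simp only: \<open>density N ?D = P\<close>)
    qed
    moreover have "AE x in P. ?D x \<noteq> \<infinity>"
      using absolutely_continuous_AE[OF _ True] sets
        N.RN_deriv_finite[OF P.sigma_finite_measure_axioms True] by auto
    ultimately have ed: "AE x in P. entropy_density (exp 1) ?Q P x = entropy_density (exp 1) N P x - ln (r x)"
    proof (eventually_elim)
      fix x assume x: "ennreal (r x) * ?E x = ?D x" "0 < ?D x" "?D x \<noteq> \<infinity>"
      then have "0 < r x" by (metis ennreal_eq_0_iff less_numeral_extra(3) mult_zero_left not_less)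
      with x have "0 < enn2real (?E x)"
        by (cases "?E x") (auto simp: ennreal_mult_top enn2real_positive_iff less_le)
      moreover have "enn2real (?D x) = r x * enn2real (?E x)"
        using x(1)[symmetric] \<open>0 < r x\<close> by (simp add: enn2real_mult)
      ultimately show "entropy_density (exp 1) ?Q P x = entropy_density (exp 1) N P x - ln (r x)"
        using \<open>0 < r x\<close> by (simp add: entropy_density_def log_def ln_mult)
    qed
    have "ext_expectation P (\<lambda>x. ereal (entropy_density (exp 1) ?Q P x)) =
      ext_expectation P (\<lambda>x. ereal (entropy_density (exp 1) N P x - ln (r x)))"
      using ed by (intro ext_expectation_cong_AE) auto
    also have "\<dots> = ext_expectation P (\<lambda>x. ereal (entropy_density (exp 1) N P x))
      - ereal (\<integral>x. ln (r x) \<partial>P)"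
      using N.log_likelihood_parts(1)[OF P True sets] int
      by (intro ext_expectation_diff_real) (auto intro: le_less_trans)
    finally show ?thesis
      using True by (simp add: KL_def ac)
  qed (simp add: KL_def ac)
qed

section \<open>Disintegration of a joint law along a regular conditional distribution\<close>

text \<open>The defining property of \<kappa> fixes the joint law on measurable rectangles, which
  form an intersection-stable generator of the product \<sigma>-algebra; finite measures agreeing
  there agree everywhere.\<close>

lemma regular_cond_distr_disintegration:
  assumes M: "prob_space M" and X[measurable]: "X \<in> M \<rightarrow>\<^sub>M S" and Y[measurable]: "Y \<in> M \<rightarrow>\<^sub>M T"
    and \<kappa>: "regular_cond_distr M S X T Y \<kappa>"
  shows "distr M (S \<Otimes>\<^sub>M T) (\<lambda>\<omega>. (X \<omega>, Y \<omega>)) =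
    distr M T Y \<bind> (\<lambda>y. distr (\<kappa> y) (S \<Otimes>\<^sub>M T) (\<lambda>x. (x, y)))" (is "?P = ?B")
proof -
  interpret M: prob_space M by fact
  have kernel: "\<kappa> \<in> T \<rightarrow>\<^sub>M prob_algebra S" using \<kappa> by (simp add: regular_cond_distr_def)
  note [measurable] = measurable_prob_algebraD[OF kernel]
  have joint[measurable]: "(\<lambda>y. distr (\<kappa> y) (S \<Otimes>\<^sub>M T) (\<lambda>x. (x, y))) \<in> T \<rightarrow>\<^sub>M subprob_algebra (S \<Otimes>\<^sub>M T)"
    by (rule measurable_distr2[where M=S]) measurable
  have ne: "space T \<noteq> {}" using M.not_empty measurable_space[OF Y] by auto
  have sets_B: "sets ?B = sets (S \<Otimes>\<^sub>M T)"
    using ne by (subst sets_bind[where N="S \<Otimes>\<^sub>M T"]) (auto simp: measurable_space[OF joint, unfolded space_subprob_algebra])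
  show ?thesis
  proof (rule measure_eqI_generator_eq[where A="\<lambda>_. space S \<times> space T", OF Int_stable_pair_measure_generator[of S T]])
    show "{a \<times> b |a b. a \<in> sets S \<and> b \<in> sets T} \<subseteq> Pow (space S \<times> space T)"
      by (auto dest: sets.sets_into_space)
  next
    fix Z assume "Z \<in> {a \<times> b |a b. a \<in> sets S \<and> b \<in> sets T}"
    then obtain A B where Z: "Z = A \<times> B" and [measurable]: "A \<in> sets S" "B \<in> sets T" by auto
    have "emeasure ?P Z = emeasure M {\<omega>\<in>space M. X \<omega> \<in> A \<and> Y \<omega> \<in> B}"
      unfolding Z by (subst emeasure_distr) (auto intro!: arg_cong[where f="emeasure M"])
    also have "\<dots> = (\<integral>\<^sup>+y\<in>B. emeasure (\<kappa> y) A \<partial>distr M T Y)"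
      using \<kappa> by (simp add: regular_cond_distr_def)
    also have "\<dots> = (\<integral>\<^sup>+y. emeasure (distr (\<kappa> y) (S \<Otimes>\<^sub>M T) (\<lambda>x. (x, y))) Z \<partial>distr M T Y)"
    proof (intro nn_integral_cong)
      fix y assume "y \<in> space (distr M T Y)"
      then have y: "y \<in> space T" by simp
      have sets_\<kappa>[measurable_cong]: "sets (\<kappa> y) = sets S"
        using measurable_space[OF kernel y] by (simp add: space_prob_algebra)
      \<comment> \<open>The section of the rectangle at \<open>y\<close> reproduces the indicator of
        \<open>B\<close> in the set integral.\<close>
      have "(\<lambda>x. (x, y)) -` Z \<inter> space (\<kappa> y) = (if y \<in> B then A else {})"
        using sets.sets_into_space[OF \<open>A \<in> sets S\<close>] sets_eq_imp_space_eq[OF sets_\<kappa>] by (auto simp: Z)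
      then show "emeasure (\<kappa> y) A * indicator B y = emeasure (distr (\<kappa> y) (S \<Otimes>\<^sub>M T) (\<lambda>x. (x, y))) Z"
        using y by (subst emeasure_distr) (auto simp: Z)
    qed
    also have "\<dots> = emeasure ?B Z"
      using ne by (subst emeasure_bind[where N="S \<Otimes>\<^sub>M T"]) (auto simp: Z)
    finally show "emeasure ?P Z = emeasure ?B Z" .
  next
    show "emeasure ?P (space S \<times> space T) \<noteq> \<infinity>" for i :: nat
      using M.prob_space_distr[of "\<lambda>\<omega>. (X \<omega>, Y \<omega>)" "S \<Otimes>\<^sub>M T"]
      by (simp add: prob_space.emeasure_le_1 finite_measure.emeasure_finite prob_space.finite_measure)
  qed (auto simp: sets_B sets_pair_measure)
qed

text \<open>Integrates a bounded function against the disintegrated law: the bounds \<open>B\<close>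
  on \<open>f\<close> and 1 on the kernel masses are what \<open>integral_bind\<close> asks for.
  Measurability in \<open>y\<close> comes from that of the kernel as a map into
  \<open>subprob_algebra\<close>.\<close>

lemma regular_cond_distr_integral:
  fixes f :: "'b \<times> 'c \<Rightarrow> real"
  assumes M: "prob_space M" and X[measurable]: "X \<in> M \<rightarrow>\<^sub>M S" and Y[measurable]: "Y \<in> M \<rightarrow>\<^sub>M T"
    and \<kappa>: "regular_cond_distr M S X T Y \<kappa>"
    and f[measurable]: "f \<in> borel_measurable (S \<Otimes>\<^sub>M T)"
    and bound: "\<And>x y. x \<in> space S \<Longrightarrow> y \<in> space T \<Longrightarrow> \<bar>f (x, y)\<bar> \<le> B"
  shows "(\<integral>\<omega>. f (X \<omega>, Y \<omega>) \<partial>M) = (\<integral>y. \<integral>x. f (x, y) \<partial>\<kappa> y \<partial>distr M T Y)"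
    and "(\<lambda>y. \<integral>x. f (x, y) \<partial>\<kappa> y) \<in> borel_measurable T"
proof -
  interpret M: prob_space M by fact
  interpret Y: prob_space "distr M T Y" by (rule M.prob_space_distr) fact
  have kernel: "\<kappa> \<in> T \<rightarrow>\<^sub>M prob_algebra S" using \<kappa> by (simp add: regular_cond_distr_def)
  note [measurable] = measurable_prob_algebraD[OF kernel]
  let ?k = "\<lambda>y. distr (\<kappa> y) (S \<Otimes>\<^sub>M T) (\<lambda>x. (x, y))"
  have joint[measurable]: "?k \<in> T \<rightarrow>\<^sub>M subprob_algebra (S \<Otimes>\<^sub>M T)"
    by (rule measurable_distr2[where M=S]) measurable
  have inner: "(\<integral>z. f z \<partial>?k y) = (\<integral>x. f (x, y) \<partial>\<kappa> y)" if y: "y \<in> space T" for y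
  proof -
    have [measurable_cong]: "sets (\<kappa> y) = sets S"
      using measurable_space[OF kernel y] by (simp add: space_prob_algebra)
    show ?thesis using y by (subst integral_distr) auto
  qed
  have "(\<integral>\<omega>. f (X \<omega>, Y \<omega>) \<partial>M) = integral\<^sup>L (distr M (S \<Otimes>\<^sub>M T) (\<lambda>\<omega>. (X \<omega>, Y \<omega>))) f"
    by (subst integral_distr) auto
  also have "\<dots> = (\<integral>y. \<integral>z. f z \<partial>?k y \<partial>distr M T Y)"
    unfolding regular_cond_distr_disintegration[OF M X Y \<kappa>]
  proof (rule integral_bind[where K="S \<Otimes>\<^sub>M T" and B=B and B'=1])
    show "\<bar>f z\<bar> \<le> B" if "z \<in> space (S \<Otimes>\<^sub>M T)" for z
      using that bound by (auto simp: space_pair_measure)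
  next
    show "AE y in distr M T Y. emeasure (?k y) (space (?k y)) \<le> ennreal 1"
    proof (rule AE_I2)
      fix y assume "y \<in> space (distr M T Y)"
      then have "subprob_space (?k y)"
        using measurable_space[OF joint, of y] by (simp add: space_subprob_algebra)
      then show "emeasure (?k y) (space (?k y)) \<le> ennreal 1"
        using subprob_space.emeasure_space_le_1 by fastforce
    qed
  qed (use M.not_empty measurable_space[OF Y] in \<open>auto intro: Y.finite_measure_axioms\<close>)
  also have "\<dots> = (\<integral>y. \<integral>x. f (x, y) \<partial>\<kappa> y \<partial>distr M T Y)"
    by (intro Bochner_Integration.integral_cong) (auto simp: inner)
  finally show "(\<integral>\<omega>. f (X \<omega>, Y \<omega>) \<partial>M) = (\<integral>y. \<integral>x. f (x, y) \<partial>\<kappa> y \<partial>distr M T Y)" .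
  have "(\<lambda>y. \<integral>z. f z \<partial>?k y) \<in> borel_measurable T" by measurable
  then show "(\<lambda>y. \<integral>x. f (x, y) \<partial>\<kappa> y) \<in> borel_measurable T"
    by (simp cong: measurable_cong add: inner)
qed

section \<open>The model densities and the expected divergence from the model conditionals\<close>

text \<open>Averaging over a probability measure puts the normalizer Z between exp(-B) and exp(B).
  Hence Z is positive, and ln \<rho> = s - ln Z is bounded by 2B. The spaces are generic so that the
  roles of \<open>u\<close> and \<open>v\<close> can be exchanged.\<close>

lemma rho_u_given_v_properties:
  fixes s :: "'b \<Rightarrow> 'c \<Rightarrow> real"
  assumes N: "prob_space N" and sets_N: "sets N = sets S"
    and s[measurable]: "(\<lambda>(x, y). s x y) \<in> borel_measurable (S \<Otimes>\<^sub>M T)"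
    and bound: "\<And>x y. x \<in> space S \<Longrightarrow> y \<in> space T \<Longrightarrow> \<bar>s x y\<bar> \<le> B"
  shows rho_u_given_v_measurable: "(\<lambda>(x, y). rho_u_given_v N s y x) \<in> borel_measurable (S \<Otimes>\<^sub>M T)"
    and rho_u_given_v_pos: "x \<in> space S \<Longrightarrow> y \<in> space T \<Longrightarrow> 0 < rho_u_given_v N s y x"
    and ln_rho_u_given_v_bound:
      "x \<in> space S \<Longrightarrow> y \<in> space T \<Longrightarrow> \<bar>ln (rho_u_given_v N s y x)\<bar> \<le> 2 * B"
    and prob_space_nu_u_given_v: "y \<in> space T \<Longrightarrow> prob_space (nu_u_given_v N s y)"
proof -
  interpret N: prob_space N by fact
  note [measurable_cong] = sets_N
  have sp: "space N = space S" using sets_N by (rule sets_eq_imp_space_eq)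
  show meas[measurable]: "(\<lambda>(x, y). rho_u_given_v N s y x) \<in> borel_measurable (S \<Otimes>\<^sub>M T)"
    unfolding rho_u_given_v_def by measurable
  have int: "integrable N (\<lambda>x. exp (s x y))" if "y \<in> space T" for y
  proof (rule N.integrable_const_bound[where B="exp B"])
    show "AE x in N. norm (exp (s x y)) \<le> exp B"
      using bound[OF _ that] by (auto simp: sp abs_le_iff)
    show "(\<lambda>x. exp (s x y)) \<in> borel_measurable N" using that by measurable
  qed
  have s_le: "s x y \<le> B" "- B \<le> s x y" if "x \<in> space S" "y \<in> space T" for x y
    using bound[OF that] by linarith+
  have lower: "exp (- B) \<le> (\<integral>x. exp (s x y) \<partial>N)" if "y \<in> space T" for y
    using s_le[OF _ that] by (intro N.integral_ge_const int that) (auto simp: sp intro!: AE_I2)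
  have upper: "(\<integral>x. exp (s x y) \<partial>N) \<le> exp B" if "y \<in> space T" for y
    using s_le[OF _ that] by (intro N.integral_le_const int that) (auto simp: sp intro!: AE_I2)
  have Z_pos: "0 < (\<integral>x. exp (s x y) \<partial>N)" if "y \<in> space T" for y
    using lower[OF that] exp_gt_zero[of "- B"] by linarith
  show pos: "0 < rho_u_given_v N s y x" if "y \<in> space T" for x y
    using Z_pos[OF that] by (simp add: rho_u_given_v_def)
  show "\<bar>ln (rho_u_given_v N s y x)\<bar> \<le> 2 * B" if "x \<in> space S" "y \<in> space T"
  proof -
    let ?Z = "\<integral>x. exp (s x y) \<partial>N"
    have "- B \<le> ln ?Z" "ln ?Z \<le> B"
      using ln_le_cancel_iff[of "exp (- B)" ?Z] ln_le_cancel_iff[of ?Z "exp B"]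
        lower[OF that(2)] upper[OF that(2)] Z_pos[OF that(2)] by simp_all
    moreover have "ln (rho_u_given_v N s y x) = s x y - ln ?Z"
      using Z_pos[OF that(2)] by (simp add: rho_u_given_v_def ln_div)
    ultimately show ?thesis using bound[OF that] by linarith
  qed
  show "prob_space (nu_u_given_v N s y)" if y: "y \<in> space T"
  proof
    have [measurable]: "(\<lambda>x. rho_u_given_v N s y x) \<in> borel_measurable N"
      using measurable_compose[OF measurable_Pair2'[OF y] meas] by (simp add: measurable_cong_sets[OF sets_N refl])
    have "emeasure (nu_u_given_v N s y) (space (nu_u_given_v N s y)) = (\<integral>\<^sup>+x. ennreal (rho_u_given_v N s y x) \<partial>N)"
      by (simp add: nu_u_given_v_def emeasure_density cong: nn_integral_cong)
    also have "\<dots> = ennreal (\<integral>x. rho_u_given_v N s y x \<partial>N)"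
      using int[OF y] pos[OF y] by (intro nn_integral_eq_integral) (auto simp: rho_u_given_v_def intro!: AE_I2 less_imp_le)
    also have "(\<integral>x. rho_u_given_v N s y x \<partial>N) = 1"
      using Z_pos[OF y] by (simp add: rho_u_given_v_def)
    finally show "emeasure (nu_u_given_v N s y) (space (nu_u_given_v N s y)) = 1" by simp
  qed
qed

text \<open>On each fibre, \<open>KL_density_right\<close> with r = \<rho> splits off the mean of ln
  \<rho>. This mean is bounded and measurable in \<open>y\<close>, so it can be integrated
  separately, and disintegration turns its integral into one over \<open>M\<close>.\<close>

lemma expected_KL_nu_u_given_v:
  fixes s :: "'b \<Rightarrow> 'c \<Rightarrow> real"
  assumes M: "prob_space M" and X[measurable]: "X \<in> M \<rightarrow>\<^sub>M S" and Y[measurable]: "Y \<in> M \<rightarrow>\<^sub>M T"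
    and \<kappa>: "regular_cond_distr M S X T Y \<kappa>"
    and s[measurable]: "(\<lambda>(x, y). s x y) \<in> borel_measurable (S \<Otimes>\<^sub>M T)"
    and bound: "\<And>x y. x \<in> space S \<Longrightarrow> y \<in> space T \<Longrightarrow> \<bar>s x y\<bar> \<le> B"
  defines "N \<equiv> distr M S X"
  shows "expected_KL (distr M T Y) \<kappa> (nu_u_given_v N s) =
      expected_KL (distr M T Y) \<kappa> (\<lambda>_. N) - ereal (\<integral>\<omega>. ln (rho_u_given_v N s (Y \<omega>) (X \<omega>)) \<partial>M)"
    and "0 \<le> expected_KL (distr M T Y) \<kappa> (\<lambda>_. N)"
    and "integrable M (\<lambda>\<omega>. ln (rho_u_given_v N s (Y \<omega>) (X \<omega>)))"
proof -
  interpret M: prob_space M by fact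
  interpret N: prob_space N unfolding N_def by (rule M.prob_space_distr) fact
  interpret Y: prob_space "distr M T Y" by (rule M.prob_space_distr) fact
  have sets_N[measurable_cong]: "sets N = sets S" by (simp add: N_def)
  have kernel: "\<kappa> \<in> T \<rightarrow>\<^sub>M prob_algebra S" using \<kappa> by (simp add: regular_cond_distr_def)
  note rho = rho_u_given_v_properties[OF N.prob_space_axioms sets_N s bound]
  note [measurable] = rho(1)
  let ?f = "\<lambda>z. ln (rho_u_given_v N s (snd z) (fst z))"
  have f[measurable]: "?f \<in> borel_measurable (S \<Otimes>\<^sub>M T)"
    using rho(1) by (simp add: split_beta')
  have f_bound: "\<bar>?f (x, y)\<bar> \<le> 2 * B" if "x \<in> space S" "y \<in> space T" for x y
    using rho(3)[OF _ _ that] by simp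
  show "integrable M (\<lambda>\<omega>. ln (rho_u_given_v N s (Y \<omega>) (X \<omega>)))"
    using measurable_space[OF X] measurable_space[OF Y] f_bound
      measurable_compose[OF measurable_Pair[OF X Y] f]
    by (intro M.integrable_const_bound[where B="2 * B"]) (auto intro!: AE_I2)
  have \<kappa>_prob: "prob_space (\<kappa> y)" and \<kappa>_sets: "sets (\<kappa> y) = sets N" if "y \<in> space T" for y
    using measurable_space[OF kernel that] by (auto simp: space_prob_algebra sets_N)
  have \<nu>_prob: "prob_space (nu_u_given_v N s y)" if "y \<in> space T" for y
    using rho(4)[OF _ _ that] by simp
  let ?h = "\<lambda>y. \<integral>x. ?f (x, y) \<partial>\<kappa> y"
  have f_\<kappa>: "integrable (\<kappa> y) (\<lambda>x. ?f (x, y))" and h_bound: "\<bar>?h y\<bar> \<le> 2 * B" if y: "y \<in> space T" for y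
  proof -
    interpret \<kappa>: prob_space "\<kappa> y" by (rule \<kappa>_prob) fact
    have sp: "space (\<kappa> y) = space S"
      using \<kappa>_sets[OF y] sets_N by (metis sets_eq_imp_space_eq)
    have bnd: "AE x in \<kappa> y. norm (?f (x, y)) \<le> 2 * B"
      using f_bound y by (auto simp: sp intro!: AE_I2)
    have "(\<lambda>x. ?f (x, y)) \<in> borel_measurable S"
      by (rule measurable_compose[OF measurable_Pair2'[OF y] f])
    then have "(\<lambda>x. ?f (x, y)) \<in> borel_measurable (\<kappa> y)"
      using \<kappa>_sets[OF y] sets_N by (simp cong: measurable_cong_sets)
    with bnd show int: "integrable (\<kappa> y) (\<lambda>x. ?f (x, y))"
      by (intro \<kappa>.integrable_const_bound)
    have "?h y \<le> 2 * B" "- (2 * B) \<le> ?h y"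
      by (rule \<kappa>.integral_le_const[OF int] \<kappa>.integral_ge_const[OF int],
          use bnd in eventually_elim, simp add: abs_le_iff)+
    then show "\<bar>?h y\<bar> \<le> 2 * B" by linarith
  qed
  have KL_eq: "KL (\<kappa> y) (nu_u_given_v N s y) = KL (\<kappa> y) N - ereal (?h y)" if y: "y \<in> space T" for y
    unfolding nu_u_given_v_def fst_conv snd_conv
  proof (rule KL_density_right)
    have "(\<lambda>x. rho_u_given_v N s y x) \<in> borel_measurable S"
      using measurable_compose[OF measurable_Pair2'[OF y] rho(1)] by simp
    then show "rho_u_given_v N s y \<in> borel_measurable N"
      by (simp add: measurable_cong_sets[OF sets_N refl])
    show "0 < rho_u_given_v N s y x" if "x \<in> space N" for x
      using rho(2)[OF _ _ _ y, of x] that by (simp add: N_def)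
    show "integrable (\<kappa> y) (\<lambda>x. ln (rho_u_given_v N s y x))"
      using f_\<kappa>[OF y] by simp
    show "prob_space (density N (\<lambda>x. ennreal (rho_u_given_v N s y x)))"
      using \<nu>_prob[OF y] by (simp add: nu_u_given_v_def)
  qed (use \<kappa>_prob \<kappa>_sets y in \<open>auto intro: N.prob_space_axioms\<close>)
  \<comment> \<open>Nonnegativity of both divergences permits
    \<open>ext_expectation_diff_nonneg\<close>, which does not ask the divergence to be measurable
    in \<open>y\<close>.\<close>
  have KL_N: "0 \<le> KL (\<kappa> y) N" if "y \<in> space T" for y
    using that by (intro KL_nonneg_ereal N.prob_space_axioms \<kappa>_prob \<kappa>_sets)
  have KL_\<nu>: "0 \<le> KL (\<kappa> y) (nu_u_given_v N s y)" if "y \<in> space T" for y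
    using that by (intro KL_nonneg_ereal \<nu>_prob \<kappa>_prob) (auto simp: \<kappa>_sets nu_u_given_v_def)
  have "integrable (distr M T Y) ?h"
    using regular_cond_distr_integral(2)[OF M X Y \<kappa> f f_bound] h_bound
    by (intro Y.integrable_const_bound[where B="2 * B"]) (auto intro!: AE_I2)
  then have "ext_expectation (distr M T Y) (\<lambda>y. KL (\<kappa> y) N - ereal (?h y)) =
      ext_expectation (distr M T Y) (\<lambda>y. KL (\<kappa> y) N) - ereal (\<integral>y. ?h y \<partial>distr M T Y)"
    using KL_N KL_\<nu> by (intro ext_expectation_diff_nonneg) (auto simp: KL_eq)
  moreover have "expected_KL (distr M T Y) \<kappa> (nu_u_given_v N s) =
      ext_expectation (distr M T Y) (\<lambda>y. KL (\<kappa> y) N - ereal (?h y))"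
    unfolding expected_KL_def by (intro ext_expectation_cong_AE AE_I2) (simp add: KL_eq)
  ultimately show "expected_KL (distr M T Y) \<kappa> (nu_u_given_v N s) =
      expected_KL (distr M T Y) \<kappa> (\<lambda>_. N) - ereal (\<integral>\<omega>. ln (rho_u_given_v N s (Y \<omega>) (X \<omega>)) \<partial>M)"
    using regular_cond_distr_integral(1)[OF M X Y \<kappa> f f_bound] by (simp add: expected_KL_def)
  show "0 \<le> expected_KL (distr M T Y) \<kappa> (\<lambda>_. N)"
    unfolding expected_KL_def by (subst ext_expectation_nonneg) (auto simp: KL_N)
qed

section \<open>The score of unit vectors and comparison of the two objectives\<close>

text \<open>Cauchy-Schwarz for unit vectors supplies the bound 1/\<tau>, which serves as the
  constant \<open>B\<close> above.\<close>

lemma score_measurable_bounded: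
  fixes gu :: "'a \<Rightarrow> 'u \<Rightarrow> 'e::euclidean_space"
  assumes gu: "\<And>\<theta>u. gu \<theta>u \<in> U \<rightarrow>\<^sub>M restrict_space borel (sphere 0 1)"
    and gv: "\<And>\<theta>v. gv \<theta>v \<in> V \<rightarrow>\<^sub>M restrict_space borel (sphere 0 1)"
    and "0 < \<tau>"
  shows "(\<lambda>(u, v). score gu gv \<tau> \<theta> u v) \<in> borel_measurable (U \<Otimes>\<^sub>M V)"
    and "u \<in> space U \<Longrightarrow> v \<in> space V \<Longrightarrow> \<bar>score gu gv \<tau> \<theta> u v\<bar> \<le> 1 / \<tau>"
proof -
  have [measurable]: "gu (fst \<theta>) \<in> borel_measurable U" "gv (snd \<theta>) \<in> borel_measurable V"
    using gu[of "fst \<theta>"] gv[of "snd \<theta>"] by (auto simp: measurable_restrict_space2_iff)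
  show "(\<lambda>(u, v). score gu gv \<tau> \<theta> u v) \<in> borel_measurable (U \<Otimes>\<^sub>M V)"
    unfolding score_def by measurable
  assume "u \<in> space U" "v \<in> space V"
  then have "norm (gu (fst \<theta>) u) = 1" "norm (gv (snd \<theta>) v) = 1"
    using measurable_space[OF gu[of "fst \<theta>"]] measurable_space[OF gv[of "snd \<theta>"]]
    by (auto simp: space_restrict_space)
  then have "\<bar>inner (gu (fst \<theta>) u) (gv (snd \<theta>) v)\<bar> \<le> 1"
    using Cauchy_Schwarz_ineq2[of "gu (fst \<theta>) u" "gv (snd \<theta>) v"] by simp
  then show "\<bar>score gu gv \<tau> \<theta> u v\<bar> \<le> 1 / \<tau>"
    using \<open>0 < \<tau>\<close> by (simp add: score_def divide_right_mono)
qed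

text \<open>Each half of the objective is an expected relative entropy minus the integral of a log
  density. Summing the halves gives the loss plus half of \<open>a + b\<close>.\<close>

lemma J_cond_eq_L_cond:
  fixes gu :: "'a \<Rightarrow> 'u \<Rightarrow> 'e::euclidean_space"
  assumes \<mu>: "prob_space \<mu>" and sets_\<mu>[measurable_cong]: "sets \<mu> = sets (U \<Otimes>\<^sub>M V)"
    and \<mu>uv: "regular_cond_distr \<mu> U fst V snd \<mu>uv"
    and \<mu>vu: "regular_cond_distr \<mu> V snd U fst \<mu>vu"
    and gu: "\<And>\<theta>u. gu \<theta>u \<in> U \<rightarrow>\<^sub>M restrict_space borel (sphere 0 1)"
    and gv: "\<And>\<theta>v. gv \<theta>v \<in> V \<rightarrow>\<^sub>M restrict_space borel (sphere 0 1)"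
    and \<tau>: "0 < \<tau>"
  defines "a \<equiv> expected_KL (marg_v V \<mu>) \<mu>uv (\<lambda>v. marg_u U \<mu>)"
    and "b \<equiv> expected_KL (marg_u U \<mu>) \<mu>vu (\<lambda>u. marg_v V \<mu>)"
  assumes "a < \<infinity>" "b < \<infinity>"
  shows "J_cond U V \<mu> \<mu>uv \<mu>vu gu gv \<tau> \<theta> =
    ereal (L_cond U V \<mu> gu gv \<tau> \<theta> + (real_of_ereal a + real_of_ereal b) / 2)"
proof -
  let ?s = "score gu gv \<tau> \<theta>"
  note s = score_measurable_bounded[OF gu gv \<tau>, where \<theta>=\<theta>]
  have [measurable]: "fst \<in> \<mu> \<rightarrow>\<^sub>M U" "snd \<in> \<mu> \<rightarrow>\<^sub>M V" by measurable
  have s': "(\<lambda>(v, u). ?s u v) \<in> borel_measurable (V \<Otimes>\<^sub>M U)"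
    using measurable_compose[OF measurable_pair_swap' s(1)] by (simp add: split_beta')
  \<comment> \<open>The conditional of \<open>v\<close> given \<open>u\<close> is the other one for
    the transposed score, so one lemma covers both halves.\<close>
  have rho_swap: "rho_v_given_u (marg_v V \<mu>) ?s u v = rho_u_given_v (marg_v V \<mu>) (\<lambda>v u. ?s u v) u v" for u v
    by (simp add: rho_v_given_u_def rho_u_given_v_def)
  have nu_swap: "nu_v_given_u (marg_v V \<mu>) ?s = nu_u_given_v (marg_v V \<mu>) (\<lambda>v u. ?s u v)"
    by (simp add: nu_v_given_u_def nu_u_given_v_def rho_swap fun_eq_iff)
  let ?p = "\<lambda>\<omega>. ln (rho_u_given_v (marg_u U \<mu>) ?s (snd \<omega>) (fst \<omega>))"
  let ?q = "\<lambda>\<omega>. ln (rho_v_given_u (marg_v V \<mu>) ?s (fst \<omega>) (snd \<omega>))"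
  have p: "expected_KL (marg_v V \<mu>) \<mu>uv (nu_u_given_v (marg_u U \<mu>) ?s) = a - ereal (integral\<^sup>L \<mu> ?p)"
    "0 \<le> a" "integrable \<mu> ?p"
    unfolding a_def marg_u_def marg_v_def
    by (rule expected_KL_nu_u_given_v[OF \<mu> _ _ \<mu>uv s]; simp)+
  have q: "expected_KL (marg_u U \<mu>) \<mu>vu (nu_v_given_u (marg_v V \<mu>) ?s) = b - ereal (integral\<^sup>L \<mu> ?q)"
    "0 \<le> b" "integrable \<mu> ?q"
    unfolding b_def nu_swap rho_swap unfolding marg_u_def marg_v_def
    by (rule expected_KL_nu_u_given_v[OF \<mu> _ _ \<mu>vu s' s(2)]; simp)+
  have "L_cond U V \<mu> gu gv \<tau> \<theta> = - (1/2) * (integral\<^sup>L \<mu> ?p + integral\<^sup>L \<mu> ?q)"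
    using p(3) q(3) by (simp add: L_cond_def split_beta')
  \<comment> \<open>Nonnegativity excludes -\<infinity> and the assumptions exclude \<infinity>, so
    \<open>real_of_ereal\<close> returns the true values and not its default 0.\<close>
  moreover obtain a' b' where "a = ereal a'" "b = ereal b'"
    using p(2) q(2) \<open>a < \<infinity>\<close> \<open>b < \<infinity>\<close> by (cases a; cases b) auto
  ultimately show ?thesis
    unfolding J_cond_def p(1) q(1) by (simp add: field_simps)
qed

theorem theorem3p2:
  "\<exists>C :: ereal \<Rightarrow> ereal \<Rightarrow> real.
     \<forall>(U :: 'u measure) (V :: 'v measure) (\<mu> :: ('u \<times> 'v) measure)
      (\<mu>uv :: 'v \<Rightarrow> 'u measure) (\<mu>vu :: 'u \<Rightarrow> 'v measure)
      (gu :: real^'pu \<Rightarrow> 'u \<Rightarrow> real^'n) (gv :: real^'pv \<Rightarrow> 'v \<Rightarrow> real^'n) (\<tau> :: real).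
       prob_space \<mu> \<and> sets \<mu> = sets (U \<Otimes>\<^sub>M V) \<and>
       regular_cond_distr \<mu> U fst V snd \<mu>uv \<and>
       regular_cond_distr \<mu> V snd U fst \<mu>vu \<and>
       (\<forall>\<theta>u. gu \<theta>u \<in> U \<rightarrow>\<^sub>M restrict_space borel (sphere 0 1)) \<and>
       (\<forall>\<theta>v. gv \<theta>v \<in> V \<rightarrow>\<^sub>M restrict_space borel (sphere 0 1)) \<and>
       \<tau> > 0 \<and>
       expected_KL (marg_v V \<mu>) \<mu>uv (\<lambda>v. marg_u U \<mu>) < \<infinity> \<and>
       expected_KL (marg_u U \<mu>) \<mu>vu (\<lambda>u. marg_v V \<mu>) < \<infinity>
       \<longrightarrow>
       (\<forall>\<theta>. J_cond U V \<mu> \<mu>uv \<mu>vu gu gv \<tau> \<theta> =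
             ereal (L_cond U V \<mu> gu gv \<tau> \<theta>
                    + C (expected_KL (marg_v V \<mu>) \<mu>uv (\<lambda>v. marg_u U \<mu>))
                        (expected_KL (marg_u U \<mu>) \<mu>vu (\<lambda>u. marg_v V \<mu>)))) \<and>
       (\<forall>\<theta>. is_arg_min (J_cond U V \<mu> \<mu>uv \<mu>vu gu gv \<tau>) (\<lambda>_. True) \<theta> \<longleftrightarrow>
             is_arg_min (L_cond U V \<mu> gu gv \<tau>) (\<lambda>_. True) \<theta>)"
proof (rule exI[of _ "\<lambda>a b. (real_of_ereal a + real_of_ereal b) / 2"], intro allI impI, elim conjE, intro conjI)
  \<comment> \<open>The witness, half the sum of the two entropies as reals, is a function chosen
    before all spaces, measures, encoders and parameters; this expresses that the constant depends
    on the entropies only.\<close>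
  fix U :: "'u measure" and V :: "'v measure" and \<mu> \<mu>uv \<mu>vu
    and gu :: "real^'pu \<Rightarrow> 'u \<Rightarrow> real^'n" and gv :: "real^'pv \<Rightarrow> 'v \<Rightarrow> real^'n" and \<tau> :: real
  assume "prob_space \<mu>" "sets \<mu> = sets (U \<Otimes>\<^sub>M V)"
    "regular_cond_distr \<mu> U fst V snd \<mu>uv" "regular_cond_distr \<mu> V snd U fst \<mu>vu"
    "\<forall>\<theta>u. gu \<theta>u \<in> U \<rightarrow>\<^sub>M restrict_space borel (sphere 0 1)"
    "\<forall>\<theta>v. gv \<theta>v \<in> V \<rightarrow>\<^sub>M restrict_space borel (sphere 0 1)" "0 < \<tau>"
    "expected_KL (marg_v V \<mu>) \<mu>uv (\<lambda>v. marg_u U \<mu>) < \<infinity>"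
    "expected_KL (marg_u U \<mu>) \<mu>vu (\<lambda>u. marg_v V \<mu>) < \<infinity>"
  then have J: "J_cond U V \<mu> \<mu>uv \<mu>vu gu gv \<tau> \<theta> =
      ereal (L_cond U V \<mu> gu gv \<tau> \<theta>
        + (real_of_ereal (expected_KL (marg_v V \<mu>) \<mu>uv (\<lambda>v. marg_u U \<mu>))
           + real_of_ereal (expected_KL (marg_u U \<mu>) \<mu>vu (\<lambda>u. marg_v V \<mu>))) / 2)" for \<theta>
    by (intro J_cond_eq_L_cond) auto
  then show "\<forall>\<theta>. J_cond U V \<mu> \<mu>uv \<mu>vu gu gv \<tau> \<theta> =
      ereal (L_cond U V \<mu> gu gv \<tau> \<theta>
        + (real_of_ereal (expected_KL (marg_v V \<mu>) \<mu>uv (\<lambda>v. marg_u U \<mu>))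
           + real_of_ereal (expected_KL (marg_u U \<mu>) \<mu>vu (\<lambda>u. marg_v V \<mu>))) / 2)"
    by blast
  \<comment> \<open>The embedding of the reals into \<open>ereal\<close> and the addition of a real
    constant preserve and reflect strict inequality, the only relation used by
    \<open>is_arg_min\<close>.\<close>
  show "\<forall>\<theta>. is_arg_min (J_cond U V \<mu> \<mu>uv \<mu>vu gu gv \<tau>) (\<lambda>_. True) \<theta> \<longleftrightarrow>
      is_arg_min (L_cond U V \<mu> gu gv \<tau>) (\<lambda>_. True) \<theta>"
    by (simp add: is_arg_min_def J)
qed

end
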